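(* Let $C_3$ be the plane projective curve over $\mathbb{Q}$ in $\mathbb{P}^2$ with homogeneous coordinates $(x:y:z)$ defined by $$\sum_{h+i+j=3} x^h y^i z^j = 0,$$ where the sum runs over all triples $(h,i,j)$ of non-negative integers with $h+i+j=3$. Then the set of rational points of $C_3$ is $$C_3(\mathbb{Q})=\{(1:-1:0),\ (-1:0:1),\ (0:1:-1)\}.$$ *)

theory Defs
  imports Complex_Main
begin

definition proj_rel :: "('a::field \<times> 'a \<times> 'a) rel" where
  "proj_rel = {((x, y, z), (x', y', z')).
     (x, y, z) \<noteq> (0, 0, 0) \<and> (x', y', z') \<noteq> (0, 0, 0) \<and>
     (\<exists>c. c \<noteq> 0 \<and> x' = c * x \<and> y' = c * y \<and> z' = c * z)}"

lemma equiv_proj_rel: "equiv (UNIV - {(0, 0, 0)}) proj_rel"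
proof (rule equivI)
  show "proj_rel \<subseteq> (UNIV - {(0, 0, 0)}) \<times> (UNIV - {(0, 0, 0 :: 'a)})"
    by (auto simp: proj_rel_def)
  show "refl_on (UNIV - {(0, 0, 0)}) (proj_rel :: ('a \<times> 'a \<times> 'a) rel)"
    by (rule refl_onI) (auto simp: proj_rel_def intro: exI[of _ 1])
  show "sym (proj_rel :: ('a \<times> 'a \<times> 'a) rel)"
  proof (rule symI)
    fix p q :: "'a \<times> 'a \<times> 'a"
    assume "(p, q) \<in> proj_rel"
    then obtain x y z c where "p = (x, y, z)" "q = (c * x, c * y, c * z)" "c \<noteq> 0"
        "p \<noteq> (0, 0, 0)" "q \<noteq> (0, 0, 0)"
      by (auto simp: proj_rel_def)
    then show "(q, p) \<in> proj_rel"
      by (auto simp: proj_rel_def intro!: exI[of _ "inverse c"])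
  qed
  show "trans (proj_rel :: ('a \<times> 'a \<times> 'a) rel)"
  proof (rule transI)
    fix p q r :: "'a \<times> 'a \<times> 'a"
    assume "(p, q) \<in> proj_rel" and "(q, r) \<in> proj_rel"
    then obtain x y z c where p: "p = (x, y, z)" "q = (c * x, c * y, c * z)" "c \<noteq> 0" "p \<noteq> (0, 0, 0)"
      by (auto simp: proj_rel_def)
    with \<open>(q, r) \<in> proj_rel\<close> obtain d where
        "r = (d * (c * x), d * (c * y), d * (c * z))" "d \<noteq> 0"
      by (fastforce simp: proj_rel_def)
    with p show "(p, r) \<in> proj_rel"
      by (auto simp: proj_rel_def intro!: exI[of _ "d * c"])
  qed
qed

definition proj_plane :: "('a::field \<times> 'a \<times> 'a) set set" where
  "proj_plane = (UNIV - {(0, 0, 0)}) // proj_rel"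

text \<open>The point \<open>(x : y : z)\<close>; it is the empty set, hence not a point, for \<open>x = y = z = 0\<close>.\<close>

definition proj_point :: "'a::field \<Rightarrow> 'a \<Rightarrow> 'a \<Rightarrow> ('a \<times> 'a \<times> 'a) set" where
  "proj_point x y z = proj_rel `` {(x, y, z)}"

definition complete_form :: "nat \<Rightarrow> 'a::field \<Rightarrow> 'a \<Rightarrow> 'a \<Rightarrow> 'a" where
  "complete_form n x y z = (\<Sum>(h, i, j) \<in> {(h, i, j). h + i + j = n}. x ^ h * y ^ i * z ^ j)"

lemma finite_exponents: "finite {(h, i, j). h + i + j = (n::nat)}"
  by (rule finite_subset[of _ "{..n} \<times> {..n} \<times> {..n}"]) auto

lemma complete_form_scale:
  "complete_form n (c * x) (c * y) (c * z) = c ^ n * complete_form n x y z"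
  unfolding complete_form_def sum_distrib_left
  by (rule sum.cong) (auto simp: power_mult_distrib power_add algebra_simps)

text \<open>The points over \<open>'a\<close> of the curve \<open>C\<^sub>n\<close>. By homogeneity it is immaterial whether the equation
  is required for all representatives of a point or for one of them.\<close>

definition curve_points :: "nat \<Rightarrow> ('a::field \<times> 'a \<times> 'a) set set" where
  "curve_points n = {P \<in> proj_plane. \<forall>(x, y, z) \<in> P. complete_form n x y z = 0}"

lemma proj_point_in_curve_points_iff:
  assumes "(x, y, z) \<noteq> (0, 0, 0)"
  shows "proj_point x y z \<in> curve_points n \<longleftrightarrow> complete_form n x y z = 0"
proof -
  have "proj_point x y z \<in> proj_plane"
    using assms by (simp add: proj_plane_def proj_point_def quotientI)
  moreover have "(x, y, z) \<in> proj_point x y z"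
    using assms by (auto simp: proj_point_def proj_rel_def intro!: exI[of _ 1])
  moreover have "complete_form n x' y' z' = 0"
    if "complete_form n x y z = 0" "(x', y', z') \<in> proj_point x y z" for x' y' z'
    using that by (auto simp: proj_point_def proj_rel_def complete_form_scale)
  ultimately show ?thesis
    by (auto simp: curve_points_def)
qed

end

theory Submission
  imports Defs "HOL-Computational_Algebra.Nth_Powers"
begin

text \<open>
  The cubic is an elliptic curve with a rational subgroup of order three, and the proof is a descent
  by the resulting 3-isogeny and its dual. Put \<open>s = x + y + z\<close>, \<open>u = 2 s - x\<close>, \<open>v = 2 s - y\<close> and
  \<open>w = 2 s - z\<close>. The equation of the curve becomes
  \<open>u v w = 5 s^3\<close> with \<open>u + v + w = 5 s\<close>.
  The line \<open>s = 0\<close> meets the curve in the three points of the theorem, which are flexes, and \<open>u\<close>, \<open>v\<close>,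
  \<open>w\<close> are the tangents there. So it has to be shown that integer solutions have \<open>s = 0\<close>, and this
  is done by infinite descent on \<open>\<bar>s\<bar>\<close> (\<open>cubic_uvw_trivial\<close>).

  In a primitive solution \<open>u\<close>, \<open>v\<close>, \<open>w\<close> are pairwise coprime, hence they are cubes, except for a factor
  5 in one of them: \<open>u = 5 A^3\<close>, \<open>v = B^3\<close>, \<open>w = C^3\<close> and \<open>s = A B C\<close>. This gives a point of the
  isogenous curve \<open>5 A^3 + B^3 + C^3 = 5 A B C\<close> (\<open>primitive_descent\<close>).

  The line \<open>A = 0\<close> meets that curve in three flexes as well, but only \<open>(0 : 1 : -1)\<close> is rational; the other
  two are conjugate over \<open>\<rat>(\<omega>)\<close>, with \<open>\<omega>\<close> a primitive cube root of unity. For the tangents at the three,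
  \<open>L = 5 A + 3 B + 3 C\<close>, \<open>M = 5 A + 3 \<omega> B + 3 \<omega>\<^sup>2 C\<close> and the conjugate \<open>M'\<close> of \<open>M\<close>, one has
  \<open>L M M' = - 10 A^3\<close> and \<open>L + M + M' = 15 A\<close>.
  Because 2 and 5 are inert in \<open>\<int>[\<omega>]\<close>, they divide \<open>L\<close> only, and away from 3 the factors are coprime.
  So unique factorization (\<open>primitive_norm_cube\<close>, \<open>norm_coprime_factor\<close>) shows that \<open>M\<close> is a cube
  up to a unit and a factor supported at 3. The prime 3 separates three cases. If 3 does not divide
  \<open>A\<close>, or 9 divides \<open>A\<close>, a congruence shows that \<open>M\<close> itself is a cube; the relation \<open>L + M + M' = 15 A\<close>,
  rewritten in terms of the cube root of \<open>M\<close>, is then the original curve again, with a smaller value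
  of \<open>\<bar>s\<bar>\<close>. If 3 divides \<open>A\<close> exactly once, \<open>M / 3\<close> is a cube times a unit other than \<open>\<plusminus> 1\<close>, and the
  same relation fails modulo 9.
\<close>

section \<open>Coprimality, cubes and residues of integers\<close>

lemma coprime_int_by_primes:
  fixes a b :: int
  assumes "\<And>r. prime r \<Longrightarrow> r dvd a \<Longrightarrow> r dvd b \<Longrightarrow> False"
  shows "coprime a b"
proof (rule ccontr)
  assume "\<not> coprime a b"
  then have "\<bar>gcd a b\<bar> \<noteq> 1" by (simp add: coprime_iff_gcd_eq_1)
  then obtain r where "prime r" "r dvd gcd a b" using prime_factor_int by blast
  then show False using assms[of r] by simp
qed

lemma cube_inject_int:
  fixes x y :: int assumes "x ^ 3 = y ^ 3" shows "x = y"
proof (rule ccontr)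
  assume "x \<noteq> y"
  moreover have "(x - y) * (x\<^sup>2 + x * y + y\<^sup>2) = 0" using assms by algebra
  ultimately have z: "x\<^sup>2 + x * y + y\<^sup>2 = 0" by simp
  then have "(2 * x + y)\<^sup>2 + 3 * y\<^sup>2 = 0" by algebra
  then have "y = 0" using zero_le_power2[of "2 * x + y"] zero_le_power2[of y] by (smt (verit) zero_eq_power2)
  then show False using z \<open>x \<noteq> y\<close> by simp
qed

lemma coprime_cube_factor_int:
  fixes x y c :: int
  assumes "coprime x y" "x * y = c ^ 3"
  obtains a where "x = a ^ 3"
proof -
  have "nat \<bar>x\<bar> * nat \<bar>y\<bar> = nat \<bar>c\<bar> ^ 3"
    using assms(2) by (metis abs_ge_zero abs_mult nat_mult_distrib nat_power_eq power_abs)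
  then have "is_nth_power 3 (nat \<bar>x\<bar> * nat \<bar>y\<bar>)" by simp
  moreover have "coprime (nat \<bar>x\<bar>) (nat \<bar>y\<bar>)" using assms(1) by simp
  ultimately have "is_nth_power 3 (nat \<bar>x\<bar>)"
    using is_nth_power_mult_coprime_natD(1)[of "nat \<bar>x\<bar>" "nat \<bar>y\<bar>" 3]
    by (cases "x = 0"; cases "y = 0") auto
  then obtain k where "nat \<bar>x\<bar> = k ^ 3" by (rule is_nth_powerE)
  then have "\<bar>x\<bar> = int k ^ 3" by (metis abs_ge_zero int_nat_eq of_nat_power)
  then have "x = int k ^ 3 \<or> x = (- int k) ^ 3" by (simp add: abs_eq_iff')
  then show ?thesis using that by blast
qed

text \<open>
  The form \<open>p\<^sup>2 - p q + q\<^sup>2\<close> is the norm of \<open>p + q \<omega>\<close>; that it is anisotropic modulo 5 says that 5 is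
  inert in \<open>\<int>[\<omega>]\<close>.
\<close>

lemma five_dvd_norm:
  fixes p q :: int
  assumes "5 dvd p\<^sup>2 - p * q + q\<^sup>2"
  shows "5 dvd p \<and> 5 dvd q"
proof -
  have m: "(p * p - p * q + q * q) mod 5 = ((p mod 5) * (p mod 5) - (p mod 5) * (q mod 5) + (q mod 5) * (q mod 5)) mod 5"
    by (intro mod_add_cong mod_diff_cong mod_mult_cong) simp_all
  have "p mod 5 \<in> {0,1,2,3,4}" "q mod 5 \<in> {0,1,2,3,4}" by auto
  then have "p mod 5 = 0 \<and> q mod 5 = 0"
    using assms m unfolding dvd_eq_mod_eq_0 power2_eq_square by (elim insertE emptyE) simp_all
  then show ?thesis by auto
qed

lemma sum_cubes_mod3:
  fixes x y :: int
  assumes "3 dvd x ^ 3 + y ^ 3" shows "3 dvd x + y"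
proof -
  have "(x + y) ^ 3 = (x ^ 3 + y ^ 3) + 3 * (x * y * (x + y))" by algebra
  then have "3 dvd (x + y) ^ 3" using assms by simp
  then show ?thesis by (rule prime_dvd_power_int[rotated]) simp
qed

section \<open>Unique factorization of cubes among the Eisenstein integers\<close>

definition omega :: complex where
  "omega = Complex (-1/2) (sqrt 3 / 2)"

text \<open>
  The ring \<open>\<int>[\<omega>]\<close> is taken as a subset of the complex numbers, so that its arithmetic and its norm, the
  square of the modulus, are inherited from there.
\<close>

definition eisenstein :: "complex set" where
  "eisenstein = {of_int a + of_int b * omega | a b. True}"

lemma omega_squared: "omega * omega = - 1 - omega"
  by (simp add: omega_def complex_eq_iff)

lemma cnj_omega: "cnj omega = - 1 - omega"
  by (simp add: omega_def complex_eq_iff)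

lemma omega_mult_left: "omega * (omega * x) = (- 1 - omega) * x"
  by (metis mult.assoc omega_squared)

lemma eisenstein_I: "of_int a + of_int b * omega \<in> eisenstein"
  unfolding eisenstein_def by blast

lemma eisenstein_of_int [intro, simp]: "of_int a \<in> eisenstein"
  using eisenstein_I[of a 0] by simp

lemma eisenstein_numeral [intro, simp]: "numeral k \<in> eisenstein"
  using eisenstein_of_int[of "numeral k"] by simp

lemma eisenstein_0_1 [intro, simp]: "0 \<in> eisenstein" "1 \<in> eisenstein"
  using eisenstein_of_int[of 0] eisenstein_of_int[of 1] by simp_all

lemma eisenstein_add [intro, simp]:
  assumes "x \<in> eisenstein" "y \<in> eisenstein" shows "x + y \<in> eisenstein"
proof -
  obtain a b c d where "x = of_int a + of_int b * omega" "y = of_int c + of_int d * omega"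
    using assms unfolding eisenstein_def by blast
  then have "x + y = of_int (a + c) + of_int (b + d) * omega" by (simp add: algebra_simps)
  then show ?thesis using eisenstein_I by metis
qed

lemma eisenstein_mult [intro, simp]:
  assumes "x \<in> eisenstein" "y \<in> eisenstein" shows "x * y \<in> eisenstein"
proof -
  obtain a b c d where "x = of_int a + of_int b * omega" "y = of_int c + of_int d * omega"
    using assms unfolding eisenstein_def by blast
  then have "x * y = of_int (a * c - b * d) + of_int (a * d + b * c - b * d) * omega"
    by (simp add: algebra_simps omega_squared omega_mult_left)
  then show ?thesis using eisenstein_I by metis
qed

lemma eisenstein_uminus [intro, simp]:
  assumes "x \<in> eisenstein" shows "- x \<in> eisenstein"
  using eisenstein_mult[OF eisenstein_of_int[of "- 1"] assms] by simp

lemma eisenstein_diff [intro, simp]: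
  assumes "x \<in> eisenstein" "y \<in> eisenstein" shows "x - y \<in> eisenstein"
  using eisenstein_add[OF assms(1) eisenstein_uminus[OF assms(2)]] by simp

lemma eisenstein_power [intro, simp]:
  assumes "x \<in> eisenstein" shows "x ^ n \<in> eisenstein"
  using assms by (induction n) auto

lemma norm_real_omega:
  "(cmod (of_real x + of_real y * omega))\<^sup>2 = x\<^sup>2 - x * y + y\<^sup>2"
proof -
  have "(cmod (of_real x + of_real y * omega))\<^sup>2 = (x - y / 2)\<^sup>2 + (y * (sqrt 3 / 2))\<^sup>2"
    by (simp add: cmod_power2 omega_def)
  also have "\<dots> = x\<^sup>2 - x * y + y\<^sup>2"
    by (simp add: power_mult_distrib power_divide, simp add: power2_eq_square field_simps)
  finally show ?thesis .
qed

lemma norm_eisenstein: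
  "(cmod (of_int a + of_int b * omega))\<^sup>2 = of_int (a\<^sup>2 - a * b + b\<^sup>2)"
  using norm_real_omega[of "of_int a" "of_int b"] by simp

lemma eisenstein_eq_iff:
  "of_int a + of_int b * omega = of_int c + of_int d * omega \<longleftrightarrow> a = c \<and> b = d"
  by (auto simp: omega_def complex_eq_iff)

lemma eisenstein_norm_int:
  assumes "x \<in> eisenstein"
  shows "(cmod x)\<^sup>2 = of_int \<lfloor>(cmod x)\<^sup>2\<rfloor>"
  using assms norm_eisenstein unfolding eisenstein_def by (smt (verit) floor_of_int mem_Collect_eq)

text \<open>
  Rounding both coordinates of \<open>x / y\<close> leaves a remainder with coordinates at most \<open>1/2\<close> in absolute
  value, so that the norm of the remainder is at most \<open>3/4\<close> of that of \<open>y\<close>.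
\<close>

lemma eisenstein_division:
  assumes "x \<in> eisenstein" "y \<in> eisenstein" "y \<noteq> 0"
  shows "\<exists>q \<in> eisenstein. cmod (x - q * y) < cmod y"
proof -
  define z where "z = x / y"
  define t where "t = Im z / (sqrt 3 / 2)"
  define r where "r = Re z + t / 2"
  have z: "z = of_real r + of_real t * omega"
    by (simp add: complex_eq_iff omega_def r_def t_def)
  define q where "q = of_int (round r) + of_int (round t) * omega"
  define dr where "dr = r - of_int (round r)"
  define dt where "dt = t - of_int (round t)"
  have "\<bar>dr\<bar> \<le> 1/2" "\<bar>dt\<bar> \<le> 1/2"
    using of_int_round_abs_le[of r] of_int_round_abs_le[of t] by (simp_all add: dr_def dt_def abs_minus_commute)
  then have "\<bar>dr\<bar> * \<bar>dr\<bar> \<le> (1/2) * (1/2)" "\<bar>dt\<bar> * \<bar>dt\<bar> \<le> (1/2) * (1/2)"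
    "\<bar>dr\<bar> * \<bar>dt\<bar> \<le> (1/2) * (1/2)"
    by (intro mult_mono; simp)+
  moreover have "z - q = of_real dr + of_real dt * omega"
    by (simp add: z q_def dr_def dt_def algebra_simps)
  then have "(cmod (z - q))\<^sup>2 = dr\<^sup>2 - dr * dt + dt\<^sup>2" using norm_real_omega by simp
  moreover have "- (dr * dt) \<le> \<bar>dr\<bar> * \<bar>dt\<bar>" by (metis abs_ge_minus_self abs_mult)
  ultimately have "(cmod (z - q))\<^sup>2 < 1" by (simp add: power2_eq_square)
  then have "cmod (z - q) < 1" by (simp add: abs_square_less_1)
  moreover have "x - q * y = (z - q) * y" using assms(3) by (simp add: z_def field_simps)
  ultimately have "cmod (x - q * y) < cmod y" using assms(3) by (simp add: norm_mult)
  moreover have "q \<in> eisenstein" unfolding q_def by (rule eisenstein_I)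
  ultimately show ?thesis by blast
qed

text \<open>
  Euclid's algorithm; the combination \<open>r x + s y\<close> is a greatest common divisor of \<open>x\<close> and \<open>y\<close>.
\<close>

lemma eisenstein_bezout:
  assumes "x \<in> eisenstein" "y \<in> eisenstein"
  shows "\<exists>r \<in> eisenstein. \<exists>s \<in> eisenstein. \<exists>g \<in> eisenstein. \<exists>h \<in> eisenstein.
    x = g * (r * x + s * y) \<and> y = h * (r * x + s * y)"
  using assms
proof (induction "nat \<lfloor>(cmod y)\<^sup>2\<rfloor>" arbitrary: x y rule: less_induct)
  case less
  show ?case
  proof (cases "y = 0")
    case True
    then show ?thesis by (intro bexI[of _ 1] bexI[of _ 0]) auto
  next
    case False
    obtain q where q: "q \<in> eisenstein" "cmod (x - q * y) < cmod y"
      using eisenstein_division less.prems False by blast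
    define z where "z = x - q * y"
    have zE: "z \<in> eisenstein" using q less.prems by (simp add: z_def)
    have "(cmod z)\<^sup>2 < (cmod y)\<^sup>2" using q by (simp add: z_def power_strict_mono)
    then have "nat \<lfloor>(cmod z)\<^sup>2\<rfloor> < nat \<lfloor>(cmod y)\<^sup>2\<rfloor>"
      using eisenstein_norm_int[OF zE] eisenstein_norm_int[OF less.prems(2)]
      by (smt (verit) floor_less_iff nat_mono_iff of_int_less_iff zero_le_floor zero_le_power2)
    from less.hyps[OF this less.prems(2) zE] obtain r s g h where
      E: "r \<in> eisenstein" "s \<in> eisenstein" "g \<in> eisenstein" "h \<in> eisenstein"
      and e: "y = g * (r * y + s * z)" "z = h * (r * y + s * z)" by blast
    have d: "r * y + s * z = s * x + (r - s * q) * y" by (simp add: z_def algebra_simps)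
    have "x = z + q * y" by (simp add: z_def)
    also have "\<dots> = (h + q * g) * (r * y + s * z)"
      using e by (metis distrib_right mult.assoc)
    finally have "x = (h + q * g) * (s * x + (r - s * q) * y)" unfolding d .
    moreover have "y = g * (s * x + (r - s * q) * y)" using e(1) unfolding d .
    moreover have "h + q * g \<in> eisenstein" "r - s * q \<in> eisenstein" using E q by auto
    ultimately show ?thesis using E by blast
  qed
qed

text \<open>
  If \<open>d\<close> generates the ideal \<open>(x, c)\<close>, then \<open>d^3\<close> and \<open>x\<close> divide each other: \<open>x\<close> divides every term
  of the expansion of \<open>(r x + s c)^3\<close>, because \<open>c^3 = x y\<close>; and the ideal \<open>(d^3)\<close> contains \<open>x^3\<close> and
  \<open>c^3\<close>, hence also \<open>x = x (u x + v y)\<^sup>2\<close>.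
\<close>

lemma eisenstein_coprime_factor_of_cube:
  assumes E: "x \<in> eisenstein" "y \<in> eisenstein" "c \<in> eisenstein" "u \<in> eisenstein" "v \<in> eisenstein"
    and "x * y = c ^ 3" "u * x + v * y = 1" "x \<noteq> 0"
  shows "\<exists>e \<in> eisenstein. \<exists>e' \<in> eisenstein. \<exists>d \<in> eisenstein. e * e' = 1 \<and> x = e * d ^ 3"
proof -
  obtain r s g h where F: "r \<in> eisenstein" "s \<in> eisenstein" "g \<in> eisenstein" "h \<in> eisenstein"
    and e: "x = g * (r * x + s * c)" "c = h * (r * x + s * c)"
    using eisenstein_bezout[OF E(1,3)] by blast
  define d where "d = r * x + s * c"
  \<comment> \<open>the cofactors \<open>d^3 / x\<close> and \<open>x / d^3\<close>\<close>
  define e1 where "e1 = r^3 * x^2 + 3 * r^2 * x * s * c + 3 * r * s^2 * c^2 + s^3 * y"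
  define e2 where "e2 = u^2 * g^3 + 2 * u * v * x * h^3 + v^2 * y * h^3"
  have x3: "x^3 = g^3 * d^3" and c3: "c^3 = h^3 * d^3"
    using e unfolding d_def by (metis power_mult_distrib)+
  have "d^3 = x * (r^3 * x^2 + 3 * r^2 * x * s * c + 3 * r * s^2 * c^2) + s^3 * c^3"
    unfolding d_def by (simp add: power2_eq_square power3_eq_cube algebra_simps)
  also have "\<dots> = x * e1" unfolding e1_def assms(6)[symmetric] by (simp add: algebra_simps)
  finally have 1: "d^3 = x * e1" .
  have "x = x * (u * x + v * y)^2" using assms(7) by simp
  also have "\<dots> = u^2 * x^3 + 2 * u * v * x * (x * y) + v^2 * y * (x * y)"
    by (simp add: power2_eq_square power3_eq_cube algebra_simps)
  also have "\<dots> = e2 * d^3" unfolding assms(6) x3 c3 unfolding e2_def x3 c3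
    by (simp add: algebra_simps x3)
  finally have 2: "x = e2 * d^3" .
  have "x * (e2 * e1) = x" using 1 2 by (simp add: mult.left_commute mult.commute)
  then have "e2 * e1 = 1" using assms(8) by simp
  moreover have "e1 \<in> eisenstein" "e2 \<in> eisenstein" "d \<in> eisenstein"
    using E F by (auto simp: e1_def e2_def d_def)
  ultimately show ?thesis using 2 by blast
qed

lemma eisenstein_units:
  assumes "e \<in> eisenstein" "e' \<in> eisenstein" "e * e' = 1"
  shows "e \<in> {1, -1, omega, - omega, 1 + omega, - 1 - omega}"
proof -
  obtain a b where e: "e = of_int a + of_int b * omega" using assms unfolding eisenstein_def by blast
  obtain c d where e': "e' = of_int c + of_int d * omega" using assms unfolding eisenstein_def by blast
  have "(cmod e)\<^sup>2 * (cmod e')\<^sup>2 = 1"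
    using assms(3) by (metis norm_mult norm_one power_mult_distrib power_one)
  then have "of_int ((a\<^sup>2 - a * b + b\<^sup>2) * (c\<^sup>2 - c * d + d\<^sup>2)) = (1::real)"
    unfolding e e' norm_eisenstein by simp
  then have "(a\<^sup>2 - a * b + b\<^sup>2) * (c\<^sup>2 - c * d + d\<^sup>2) = 1" by (metis of_int_eq_1_iff)
  moreover have "a\<^sup>2 - a * b + b\<^sup>2 \<ge> 0"
    using norm_eisenstein[of a b] by (metis of_int_0_le_iff zero_le_power2)
  ultimately have n: "a\<^sup>2 - a * b + b\<^sup>2 = 1" by (smt (verit) zmult_eq_1_iff)
  \<comment> \<open>completing the square in either variable bounds the other one\<close>
  have "(2*a - b)\<^sup>2 + 3 * b\<^sup>2 = 4" "(2*b - a)\<^sup>2 + 3 * a\<^sup>2 = 4"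
    using n by (simp_all add: power2_eq_square algebra_simps)
  then have "b\<^sup>2 < 2\<^sup>2" "a\<^sup>2 < 2\<^sup>2"
    using zero_le_power2[of "2*a-b"] zero_le_power2[of "2*b-a"] by (simp_all, linarith+)
  then have "\<bar>b\<bar> < 2" "\<bar>a\<bar> < 2"
    by (metis power2_less_imp_less power2_abs zero_le_numeral)+
  then have "a \<in> {-1, 0, 1}" "b \<in> {-1, 0, 1}" by auto
  then show ?thesis using n unfolding e by auto
qed

lemma cube_eisenstein:
  "(of_int a + of_int b * omega) ^ 3 =
     of_int (a^3 - 3*a*b^2 + b^3) + of_int (3*a*b*(a - b)) * omega"
  by (simp add: power2_eq_square power3_eq_cube algebra_simps omega_squared omega_mult_left)

text \<open>
  The ideal generated by \<open>x = p + q \<omega>\<close> and its conjugate contains the multiples \<open>p \<delta>\<close> and \<open>q \<delta>\<close> of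
  \<open>\<delta> = 1 + 2 \<omega> = \<surd>-3\<close>, hence \<open>\<delta>\<close> itself and \<open>3 = - \<delta>\<^sup>2\<close>. It also contains the norm of \<open>x\<close>, which is
  prime to 3.
\<close>

lemma primitive_eisenstein_bezout:
  fixes p q :: int
  assumes "coprime p q" "\<not> 3 dvd p\<^sup>2 - p * q + q\<^sup>2"
  defines "x \<equiv> of_int p + of_int q * omega"
  shows "\<exists>u \<in> eisenstein. \<exists>v \<in> eisenstein. u * x + v * cnj x = 1"
proof -
  define N where "N = p\<^sup>2 - p * q + q\<^sup>2"
  have "coprime 3 N" using assms(2) prime_imp_coprime[of 3 N] by (simp add: N_def)
  then obtain i j where ij: "i * 3 + j * N = 1" by (metis coprime_iff_gcd_eq_1 bezout_int)
  obtain k l where kl: "k * p + l * q = 1" using assms(1) by (metis coprime_iff_gcd_eq_1 bezout_int)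
  have cx: "cnj x = of_int (p - q) - of_int q * omega"
    by (simp add: x_def cnj_omega algebra_simps)
  have xN: "x * cnj x = of_int N"
    by (simp add: cx N_def, simp add: x_def power2_eq_square algebra_simps omega_squared omega_mult_left)
  \<comment> \<open>\<open>m = - \<delta>\<close>, and \<open>a\<close>, \<open>b\<close> are the coefficients that produce \<open>\<delta>\<close>\<close>
  define m where "m = - 1 - 2 * omega"
  define a where "a = of_int k * (1 + omega) + of_int l"
  define b where "b = of_int k * omega - of_int l"
  have "a * x + b * cnj x = of_int (k * p + l * q) * (1 + 2 * omega)"
    by (simp add: cx a_def b_def, simp add: x_def algebra_simps omega_squared omega_mult_left)
  then have ab: "a * x + b * cnj x = 1 + 2 * omega" by (simp add: kl)
  have "(of_int i * m * a + of_int j * cnj x) * x + of_int i * m * b * cnj x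
       = of_int i * m * (a * x + b * cnj x) + of_int j * (x * cnj x)"
    by (simp add: algebra_simps)
  also have "\<dots> = of_int (i * 3 + j * N)"
    unfolding ab xN m_def by (simp add: algebra_simps omega_squared omega_mult_left)
  finally have "(of_int i * m * a + of_int j * cnj x) * x + of_int i * m * b * cnj x = 1"
    by (simp add: ij)
  moreover have "omega \<in> eisenstein" using eisenstein_I[of 0 1] by simp
  then have "of_int i * m * a + of_int j * cnj x \<in> eisenstein" "of_int i * m * b \<in> eisenstein"
    unfolding m_def a_def b_def cx by (auto simp del: of_int_diff)
  ultimately show ?thesis by blast
qed

text \<open>
  The conclusion says that \<open>p + q \<omega>\<close> is \<open>1\<close>, \<open>\<omega>\<close> or \<open>\<omega>\<^sup>2\<close> times \<open>P + Q \<omega> = (a + b \<omega>)^3\<close>, in that order;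
  the unit \<open>-1\<close> is absorbed by the cube.
\<close>

lemma primitive_norm_cube:
  fixes p q n :: int
  assumes "coprime p q" and cube: "p\<^sup>2 - p * q + q\<^sup>2 = n ^ 3" and "\<not> 3 dvd p\<^sup>2 - p * q + q\<^sup>2"
  obtains a b P Q where "n = a\<^sup>2 - a * b + b\<^sup>2"
    "P = a^3 - 3*a*b^2 + b^3" "Q = 3*a*b*(a - b)"
    "p = P \<and> q = Q \<or> p = - Q \<and> q = P - Q \<or> p = Q - P \<and> q = - P"
proof -
  define x where "x = of_int p + of_int q * omega"
  have cx: "cnj x = of_int (p - q) - of_int q * omega"
    by (simp add: x_def cnj_omega algebra_simps)
  have xE: "x \<in> eisenstein" unfolding x_def by (rule eisenstein_I)
  have cE: "cnj x \<in> eisenstein" using eisenstein_I[of "p - q" "- q"] by (simp add: cx)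
  have "x * cnj x = of_int (n ^ 3)" unfolding cube[symmetric]
    by (simp add: cx, simp add: x_def power2_eq_square algebra_simps omega_squared omega_mult_left)
  then have xc: "x * cnj x = of_int n ^ 3" by simp
  have x0: "x \<noteq> 0"
    using assms(1) eisenstein_eq_iff[of p q 0 0] by (auto simp: x_def)
  from primitive_eisenstein_bezout[OF assms(1,3)] obtain u v
    where uv: "u \<in> eisenstein" "v \<in> eisenstein" "u * x + v * cnj x = 1"
    unfolding x_def[symmetric] by (elim bexE)
  from eisenstein_coprime_factor_of_cube[OF xE cE eisenstein_of_int uv(1,2) xc uv(3) x0]
  obtain e e' d where e: "e \<in> eisenstein" "e' \<in> eisenstein" "e * e' = 1"
    and d: "d \<in> eisenstein" "x = e * d ^ 3"
    by (elim bexE conjE)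
  note eu = eisenstein_units[OF e]
  have "\<exists>d \<in> eisenstein. x = d ^ 3 \<or> x = omega * d ^ 3 \<or> x = (- 1 - omega) * d ^ 3"
  proof -
    have m: "- d \<in> eisenstein" "(- d) ^ 3 = - (d ^ 3)" using d by auto
    have "\<exists>z \<in> {1, omega, - 1 - omega}. e = z \<or> e = - z"
      using eu by auto
    then have "\<exists>z \<in> {1, omega, - 1 - omega}. x = z * d ^ 3 \<or> x = z * (- d) ^ 3"
      by (elim bexE disjE) (intro bexI, auto simp: d(2) m(2))+
    then show ?thesis using d(1) m(1) by (metis empty_iff insert_iff mult_1)
  qed
  then obtain a b where ab: "let d = of_int a + of_int b * omega in
      x = d ^ 3 \<or> x = omega * d ^ 3 \<or> x = (- 1 - omega) * d ^ 3"
    unfolding eisenstein_def Let_def by blast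
  define P where "P = a^3 - 3*a*b^2 + b^3"
  define Q where "Q = 3*a*b*(a - b)"
  have c: "(of_int a + of_int b * omega) ^ 3 = of_int P + of_int Q * omega"
    unfolding P_def Q_def by (rule cube_eisenstein)
  have "omega * (of_int P + of_int Q * omega) = of_int (- Q) + of_int (P - Q) * omega"
    "(- 1 - omega) * (of_int P + of_int Q * omega) = of_int (Q - P) + of_int (- P) * omega"
    by (simp_all add: algebra_simps omega_squared omega_mult_left)
  then have pq: "p = P \<and> q = Q \<or> p = - Q \<and> q = P - Q \<or> p = Q - P \<and> q = - P"
    using ab unfolding Let_def c x_def by (metis eisenstein_eq_iff)
  have "P\<^sup>2 - P * Q + Q\<^sup>2 = (a\<^sup>2 - a * b + b\<^sup>2) ^ 3"
    unfolding P_def Q_def by algebra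
  moreover have "p\<^sup>2 - p * q + q\<^sup>2 = P\<^sup>2 - P * Q + Q\<^sup>2"
    using pq by (auto simp: power2_eq_square algebra_simps)
  ultimately have "n ^ 3 = (a\<^sup>2 - a * b + b\<^sup>2) ^ 3" using cube by simp
  then have "n = a\<^sup>2 - a * b + b\<^sup>2" by (rule cube_inject_int)
  then show ?thesis using that pq P_def Q_def by blast
qed

section \<open>The norm form with constant ten\<close>

text \<open>
  The common core of the three cases of the descent. The hypotheses make \<open>p + q \<omega>\<close> primitive and its
  norm \<open>N\<close> coprime to 10 and to \<open>L\<close>, so that \<open>N\<close> and \<open>L / 10\<close> are both cubes. Primitivity uses that 10 is
  squarefree: a common prime factor of \<open>p\<close> and \<open>q\<close> would divide \<open>10 A^3\<close> twice, hence divide \<open>A\<close>.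
\<close>

lemma norm_coprime_factor:
  fixes A L p q :: int
  defines "N \<equiv> p\<^sup>2 - p * q + q\<^sup>2"
  assumes eq: "L * N = - 10 * A ^ 3"
    and NL: "\<And>r. prime r \<Longrightarrow> r dvd A \<Longrightarrow> r dvd N \<Longrightarrow> r dvd L \<Longrightarrow> False"
    and pq: "\<And>r. prime r \<Longrightarrow> r dvd A \<Longrightarrow> r dvd p \<Longrightarrow> r dvd q \<Longrightarrow> False"
    and N5: "\<not> 5 dvd N" and N3: "\<not> 3 dvd N"
  obtains n l a b P Q where "A = n * l" "L = - 10 * l ^ 3" "n = a\<^sup>2 - a * b + b\<^sup>2"
    "P = a^3 - 3*a*b^2 + b^3" "Q = 3*a*b*(a - b)"
    "p = P \<and> q = Q \<or> p = - Q \<and> q = P - Q \<or> p = Q - P \<and> q = - P"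
proof -
  have prim: "coprime p q"
  proof (rule coprime_int_by_primes)
    fix r assume r: "prime r" "r dvd p" "r dvd q"
    then obtain p' q' where "p = r * p'" "q = r * q'" by (auto simp: dvd_def)
    then have "N = r\<^sup>2 * (p'\<^sup>2 - p' * q' + q'\<^sup>2)"
      by (simp add: N_def power2_eq_square algebra_simps)
    then have "r\<^sup>2 dvd L * N" by simp
    then have d: "r\<^sup>2 dvd 10 * A ^ 3" unfolding eq by simp
    have "\<not> r dvd A" using pq r by blast
    then have "coprime (r\<^sup>2) (A ^ 3)" using prime_imp_coprime[OF r(1)] by simp
    then have d10: "r\<^sup>2 dvd 10" using d by (simp add: coprime_dvd_mult_left_iff)
    then have "r * r \<le> 10" using zdvd_imp_le[of "r\<^sup>2" 10] by (simp add: power2_eq_square)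
    moreover have "r \<ge> 2" using r(1) by (rule prime_ge_2_int)
    ultimately have "r < 4" using mult_mono[of 4 r 4 r] by linarith
    then have "r = 2 \<or> r = 3" using \<open>r \<ge> 2\<close> by linarith
    then show False using d10 by auto
  qed
  have "odd N" using prim unfolding N_def by (auto simp: coprime_def)
  then have N10: "coprime N (2 * 5)"
    using N5 prime_imp_coprime[of 5 N] unfolding coprime_mult_right_iff
    by (simp add: coprime_commute)
  have "10 dvd L * N" unfolding eq by simp
  then have "10 dvd L" using N10 by (simp add: coprime_dvd_mult_left_iff coprime_commute)
  then obtain L1 where L1: "L = 10 * L1" by (auto simp: dvd_def)
  have e1: "N * L1 = (- A) ^ 3" using eq L1 by (simp add: mult.commute)
  have "coprime N L"
  proof (rule coprime_int_by_primes)
    fix r assume r: "prime r" "r dvd N" "r dvd L"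
    have "r dvd 10 * A ^ 3" using r(2) eq by (metis dvd_minus_iff dvd_mult mult_minus_left)
    moreover have "\<not> r dvd 10"
      using coprime_common_divisor[OF N10 r(2)] r(1) not_prime_unit by auto
    ultimately have "r dvd A" using r(1) by (metis prime_dvd_mult_iff prime_dvd_power)
    then show False using NL r by blast
  qed
  then have c: "coprime N L1" unfolding L1 by simp
  then obtain n where n: "N = n ^ 3" using e1 coprime_cube_factor_int by blast
  obtain k where k: "L1 = k ^ 3"
    using c e1 coprime_cube_factor_int[of L1 N] by (metis coprime_commute mult.commute)
  have "(n * k) ^ 3 = (- A) ^ 3" using e1 n k by (simp add: power_mult_distrib)
  then have A: "A = n * (- k)" using cube_inject_int by fastforce
  have L: "L = - 10 * (- k) ^ 3" using L1 k by simp
  show ?thesis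
    using primitive_norm_cube[OF prim n[unfolded N_def] N3[unfolded N_def]] that[OF A L] by metis
qed

section \<open>Descent on the isogenous curve\<close>

text \<open>
  A point on the curve that is 3-isogenous to the given one, with the coprimality that the first
  descent provides. The inequality \<open>A \<noteq> 0\<close> excludes the flex \<open>(0 : 1 : -1)\<close>, which corresponds to the
  points at \<open>s = 0\<close>.
\<close>

locale primitive_isogenous_point =
  fixes A B C :: int
  assumes eq: "5 * A ^ 3 + B ^ 3 + C ^ 3 = 5 * A * B * C"
    and cop: "coprime A B" "coprime A C" "coprime B C"
    and five: "\<not> 5 dvd B" "\<not> 5 dvd C"
    and A0: "A \<noteq> 0"
begin

lemma no_common_prime:
  assumes "prime r" "r dvd A" shows "\<not> r dvd B" "\<not> r dvd C"
  using assms cop by (meson coprime_common_divisor not_prime_unit)+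

lemma BC_nonzero: "B \<noteq> 0" "C \<noteq> 0"
  using five by auto

lemma three_dvd_sum:
  assumes "3 dvd A" shows "3 dvd B + C"
proof -
  have "B ^ 3 + C ^ 3 = A * (5 * B * C - 5 * A ^ 2)"
    using eq by (simp add: power2_eq_square power3_eq_cube algebra_simps)
  then show ?thesis using assms sum_cubes_mod3 by simp
qed

text \<open>
  Here \<open>p + q \<omega> = 5 A + 3 \<omega> B + 3 \<omega>\<^sup>2 C\<close> and \<open>L + 2 p - q = 15 A\<close> is the trace relation. Since \<open>q\<close> is
  divisible by 3 and \<open>p\<close> is not, and the cube \<open>P + Q \<omega>\<close> has \<open>Q\<close> divisible by 3, the unit is \<open>1\<close>.
\<close>

lemma descent_A_unit_mod_3:
  assumes A3: "\<not> 3 dvd A"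
  shows "\<exists>u v w t. u * v * w = 5 * t ^ 3 \<and> u + v + w = 5 * t \<and> t \<noteq> 0 \<and> \<bar>t\<bar> < \<bar>A * B * C\<bar>"
proof -
  define p q L where "p = 5 * A - 3 * C" and "q = 3 * (B - C)" and "L = 5 * A + 3 * B + 3 * C"
  define N where "N = p\<^sup>2 - p * q + q\<^sup>2"
  have 1: "L * N = - 10 * A ^ 3"
    using eq unfolding N_def L_def p_def q_def by algebra
  have 2: False if r: "prime r" "r dvd A" "r dvd N" "r dvd L" for r
  proof -
    have "\<not> r dvd 3" using r(1,2) A3 primes_dvd_imp_eq[OF r(1), of 3] by auto
    have "r dvd L - 5 * A" using r by simp
    then have "r dvd 3 * (B + C)" by (simp add: L_def algebra_simps)
    then have s: "r dvd B + C" using r(1) \<open>\<not> r dvd 3\<close> prime_dvd_mult_iff by blast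
    have "27 * (B * C) = A * (25 * A - 15 * B - 15 * C) + 9 * (B + C) * (B + C) - N"
      unfolding N_def p_def q_def by algebra
    then have "r dvd 27 * (B * C)" using r s by simp
    moreover have "27 = (3::int) ^ 3" by simp
    ultimately show False
      using r(1) \<open>\<not> r dvd 3\<close> no_common_prime[OF r(1,2)] by (metis prime_dvd_mult_iff prime_dvd_power)
  qed
  have p3: "\<not> 3 dvd p" using A3 unfolding p_def by presburger
  have 3: False if r: "prime r" "r dvd A" "r dvd p" "r dvd q" for r
  proof -
    have "r dvd 5 * A - p" using r by simp
    then have "r dvd 3 * C" by (simp add: p_def)
    moreover have "\<not> r dvd 3" using r(1,2) A3 primes_dvd_imp_eq[OF r(1), of 3] by auto
    ultimately show False using no_common_prime[OF r(1,2)] r(1) by (simp add: prime_dvd_mult_iff)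
  qed
  have 4: "\<not> 5 dvd N"
    using five_dvd_norm[of p q] five unfolding N_def p_def by presburger
  have 5: "\<not> 3 dvd N"
  proof
    assume "3 dvd N"
    moreover have "p ^ 2 = N + 3 * (p * (B - C) - 3 * (B - C) ^ 2)"
      unfolding N_def q_def by algebra
    ultimately have "3 dvd p ^ 2" by simp
    then have "3 dvd p" by (rule prime_dvd_power_int[rotated]) simp
    then show False using p3 by simp
  qed
  obtain n l a b P Q where o: "A = n * l" "L = - 10 * l ^ 3" "n = a\<^sup>2 - a * b + b\<^sup>2"
    "P = a^3 - 3*a*b^2 + b^3" "Q = 3*a*b*(a - b)"
    "p = P \<and> q = Q \<or> p = - Q \<and> q = P - Q \<or> p = Q - P \<and> q = - P"
    by (rule norm_coprime_factor[of L p q A, folded N_def, OF 1 _ _ 4 5]) (use 2 3 in blast)+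
  have Q3: "3 dvd Q" unfolding o by simp
  have q3: "3 dvd q" unfolding q_def by simp
  have pq: "p = P" "q = Q" using o(6) p3 q3 Q3 by presburger+
  have "L + 2 * p - q = 15 * A" unfolding L_def p_def q_def by simp
  then have rel: "- 10 * l ^ 3 + 2 * P - Q = 15 * (n * l)" using o pq by simp
  have "3 dvd l + (a + b)"
  proof -
    have "l ^ 3 + (a + b) ^ 3 = 3 * ((a + b) ^ 3 - 3 * l ^ 3 - 5 * n * l
        - 2 * a * b * (a + b) - 2 * a * b\<^sup>2 - a * b * (a - b))"
      using rel unfolding o(4,5) by algebra
    then have "3 dvd l ^ 3 + (a + b) ^ 3" by (rule dvdI)
    then show ?thesis by (rule sum_cubes_mod3)
  qed
  then obtain m where m: "b = 3 * m - l - a" by (metis add.commute add_diff_cancel_right' diff_diff_add dvdE)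
  \<comment> \<open>the solution of \<open>u + v + w = 5 l\<close> and \<open>u + v \<omega> + w \<omega>\<^sup>2 = a + b \<omega>\<close>, integral since 3 divides \<open>l + a + b\<close>\<close>
  define u v w where "u = 2 * l + a - m" and "v = l - a + 2 * m" and "w = 2 * l - m"
  have "27 * (u * v * w) = 27 * (5 * l ^ 3)"
    using rel unfolding o(3-5) m u_def v_def w_def by algebra
  then have "u * v * w = 5 * l ^ 3" by simp
  moreover have "u + v + w = 5 * l" by (simp add: u_def v_def w_def)
  moreover have nl: "n \<noteq> 0" "l \<noteq> 0" using A0 o(1) by auto
  moreover have "\<bar>l\<bar> < \<bar>A * B * C\<bar>"
  proof (rule ccontr)
    \<comment> \<open>\<open>l\<close> divides \<open>A\<close>, so without a strict decrease \<open>A = \<plusminus> l\<close> and \<open>B\<close>, \<open>C\<close> are \<open>\<plusminus> 1\<close>\<close>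
    assume "\<not> ?thesis"
    then have "\<bar>l\<bar> * \<bar>n * B * C\<bar> \<le> \<bar>l\<bar> * 1" by (simp add: o(1) abs_mult algebra_simps)
    then have "\<bar>n * B * C\<bar> \<le> 1" using nl by simp
    moreover have "n * B * C \<noteq> 0" using nl BC_nonzero by simp
    ultimately have "\<bar>n * B * C\<bar> = 1" by linarith
    then have one: "\<bar>n\<bar> = 1" "\<bar>B\<bar> = 1" "\<bar>C\<bar> = 1"
      by (metis abs_mult abs_abs abs_zmult_eq_1 mult.commute)+
    have "5 dvd 3 * (B + C)"
    proof -
      have "3 * (B + C) = 5 * (- 2 * l ^ 3 - A)" using o(2) unfolding L_def by simp
      then show ?thesis by simp
    qed
    then have "B + C = 0" using one by presburger
    then have "- 2 * l ^ 3 = A" using o(2) unfolding L_def by simp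
    then have "l * (2 * l\<^sup>2 + n) = 0" using o(1) by (simp add: power2_eq_square power3_eq_cube algebra_simps)
    then have "2 * l\<^sup>2 + n = 0" using nl by simp
    then show False using one by presburger
  qed
  ultimately show ?thesis by blast
qed

text \<open>
  Now the factorization is divided by 27, and \<open>p + q \<omega>\<close> is one third of
  \<open>5 A + 3 \<omega> B + 3 \<omega>\<^sup>2 C\<close>. As 3 does not divide \<open>q\<close>, the unit is \<open>\<omega>\<close> or \<open>\<omega>\<^sup>2\<close>. In both cases, with \<open>m = a + b\<close>, the trace relation reduces
  modulo 9 to \<open>10 l^3 + 15 m\<^sup>2 l + m^3 = 0\<close>, which is impossible for \<open>l\<close> and \<open>m\<close> prime to 3: the first
  two terms add up to \<open>\<plusminus> 2\<close>, and the last one is \<open>\<plusminus> 1\<close>.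
\<close>

lemma no_point_A_exactly_divisible_by_3:
  assumes A': "A = 3 * A'" and A3: "\<not> 3 dvd A'"
  shows False
proof -
  have s3: "3 dvd B + C" using three_dvd_sum A' by simp
  have B3: "\<not> 3 dvd B" "\<not> 3 dvd C" using no_common_prime[of 3] A' by simp_all
  have A'A: "r dvd A" if "r dvd A'" for r using A' that by simp
  define p q L where "p = 5 * A' - C" and "q = B - C" and "L = 5 * A' + B + C"
  define N where "N = p\<^sup>2 - p * q + q\<^sup>2"
  have "27 * (L * N) = 27 * (- 10 * A' ^ 3)"
    using eq unfolding N_def L_def p_def q_def A' by algebra
  then have 1: "L * N = - 10 * A' ^ 3" by simp
  have 2: False if r: "prime r" "r dvd A'" "r dvd N" "r dvd L" for r
  proof -
    have "\<not> r dvd 3" using r(1,2) A3 primes_dvd_imp_eq[OF r(1), of 3] by auto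
    have "r dvd L - 5 * A'" using r by simp
    then have s: "r dvd B + C" by (simp add: L_def algebra_simps)
    have "3 * (B * C) = A' * (25 * A' - 5 * B - 5 * C) + (B + C) * (B + C) - N"
      unfolding N_def p_def q_def by algebra
    then have "r dvd 3 * (B * C)" using r s by simp
    then show False
      using r(1) \<open>\<not> r dvd 3\<close> no_common_prime[OF r(1) A'A[OF r(2)]] by (metis prime_dvd_mult_iff)
  qed
  have 3: False if r: "prime r" "r dvd A'" "r dvd p" "r dvd q" for r
  proof -
    have "r dvd 5 * A' - p" using r by simp
    then have "r dvd C" by (simp add: p_def)
    then show False using no_common_prime[OF r(1) A'A[OF r(2)]] by simp
  qed
  have 4: "\<not> 5 dvd N"
    using five_dvd_norm[of p q] five unfolding N_def p_def by presburger
  have 5: "\<not> 3 dvd N"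
  proof
    assume "3 dvd N"
    moreover have "(p + q) ^ 2 = N + 3 * (p * q)" unfolding N_def by algebra
    ultimately have "3 dvd (p + q) ^ 2" by simp
    then have "3 dvd p + q" by (rule prime_dvd_power_int[rotated]) simp
    then show False using A3 s3 unfolding p_def q_def by presburger
  qed
  obtain n l a b P Q where o: "A' = n * l" "L = - 10 * l ^ 3" "n = a\<^sup>2 - a * b + b\<^sup>2"
    "P = a^3 - 3*a*b^2 + b^3" "Q = 3*a*b*(a - b)"
    "p = P \<and> q = Q \<or> p = - Q \<and> q = P - Q \<or> p = Q - P \<and> q = - P"
    by (rule norm_coprime_factor[of L p q A', folded N_def, OF 1 _ _ 4 5]) (use 2 3 in blast)+
  have "3 dvd Q" unfolding o by simp
  moreover have "\<not> 3 dvd q" using s3 B3 unfolding q_def by presburger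
  ultimately have opt: "p = - Q \<and> q = P - Q \<or> p = Q - P \<and> q = - P" using o(6) by blast
  have "L + 2 * p - q = 15 * A'" unfolding L_def p_def q_def by simp
  then have rel: "10 * l ^ 3 + 15 * (n * l) + P + Q = 0 \<or> 10 * l ^ 3 + 15 * (n * l) + P - 2 * Q = 0"
    using opt o(1,2) by auto
  define m where "m = a + b"
  have n: "n = m\<^sup>2 - 3 * (a * b)" unfolding o m_def by algebra
  have "10 * (l * l * l) + 15 * (m * m * l) + m * m * m
      = (10 * l ^ 3 + 15 * (n * l) + P + Q) + 9 * (5 * (a * b * l) + a * b\<^sup>2)"
    "10 * (l * l * l) + 15 * (m * m * l) + m * m * m
      = (10 * l ^ 3 + 15 * (n * l) + P - 2 * Q) + 9 * (5 * (a * b * l) + a\<^sup>2 * b)"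
    unfolding o m_def by algebra+
  then have "9 dvd 10 * (l * l * l) + 15 * (m * m * l) + m * m * m"
    using rel by (metis add_0 dvdI)
  then have m9: "(10 * (l * l * l) + 15 * (m * m * l) + m * m * m) mod 9 = 0" by (rule dvd_imp_mod_0)
  have "\<not> 3 dvd l" using A3 o(1) by auto
  have "\<not> 3 dvd m"
  proof
    assume "3 dvd m"
    then have "3 dvd m\<^sup>2 - 3 * (a * b)" by (simp add: power2_eq_square)
    then have "3 dvd n" unfolding n .
    then show False using A3 o(1) by auto
  qed
  have z: "(10 * ((l mod 9) * (l mod 9) * (l mod 9)) + 15 * ((m mod 9) * (m mod 9) * (l mod 9))
      + (m mod 9) * (m mod 9) * (m mod 9)) mod 9 = 0"
  proof -
    have "(10 * (l * l * l) + 15 * (m * m * l) + m * m * m) mod 9 =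
      (10 * ((l mod 9) * (l mod 9) * (l mod 9)) + 15 * ((m mod 9) * (m mod 9) * (l mod 9))
        + (m mod 9) * (m mod 9) * (m mod 9)) mod 9"
      by (intro mod_add_cong mod_mult_cong) simp_all
    then show ?thesis using m9 by simp
  qed
  have "x mod 9 \<in> {1, 2, 4, 5, 7, 8}" if "\<not> 3 dvd x" for x :: int
    using that by (simp only: insert_iff empty_iff) presburger
  then have "l mod 9 \<in> {1, 2, 4, 5, 7, 8}" "m mod 9 \<in> {1, 2, 4, 5, 7, 8}"
    using \<open>\<not> 3 dvd l\<close> \<open>\<not> 3 dvd m\<close> by blast+
  then show False using z by (elim insertE emptyE) simp_all
qed

text \<open>
  In this case \<open>5 A + 3 \<omega> B + 3 \<omega>\<^sup>2 C = 3 (1 + 2 \<omega>) (p + q \<omega>)\<close>, where the factor \<open>1 + 2 \<omega> = \<surd>-3\<close> accounts for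
  the remaining common divisor of the linear factors; the third one is \<open>5 A + 3 B + 3 C = 27 L\<close>. The
  unit is \<open>1\<close> as before, because 3 divides \<open>q\<close>.
\<close>

lemma descent_9_dvd_A:
  assumes A'': "A = 9 * A''"
  shows "\<exists>u v w t. u * v * w = 5 * t ^ 3 \<and> u + v + w = 5 * t \<and> t \<noteq> 0 \<and> \<bar>t\<bar> < \<bar>A * B * C\<bar>"
proof -
  have "3 dvd B + C" using three_dvd_sum A'' by simp
  then obtain k where "B + C = 3 * k" by (auto simp: dvd_def)
  then have k: "B = 3 * k - C" by simp
  have C3: "\<not> 3 dvd C" using no_common_prime[of 3] A'' by simp
  have A''A: "r dvd A" if "r dvd A''" for r using A'' that by simp
  define p q where "p = 2 * k - C - 5 * A''" and "q = k - 10 * A''"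
  define N where "N = p\<^sup>2 - p * q + q\<^sup>2"
  have "81 * ((5 * A'' + k) * N) = 81 * (- 30 * A'' ^ 3)"
    using eq unfolding N_def p_def q_def A'' k by algebra
  then have 0: "(5 * A'' + k) * N = - 30 * A'' ^ 3" by linarith
  have 5: "\<not> 3 dvd N"
  proof
    assume "3 dvd N"
    moreover have "(p + q) ^ 2 = N + 3 * (p * q)" unfolding N_def by algebra
    ultimately have "3 dvd (p + q) ^ 2" by simp
    then have "3 dvd p + q" by (rule prime_dvd_power_int[rotated]) simp
    then show False using C3 unfolding p_def q_def by presburger
  qed
  have "3 dvd (5 * A'' + k) * N" unfolding 0 by simp
  then have "3 dvd 5 * A'' + k" using 5 by (simp add: prime_dvd_mult_iff)
  then obtain L where L: "5 * A'' + k = 3 * L" by (auto simp: dvd_def)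
  have 1: "L * N = - 10 * A'' ^ 3" using 0 unfolding L by simp
  have kN: False if r: "prime r" "r dvd A''" "r dvd k" "r dvd N" for r
  proof -
    have "C * C = N - (p + C) * (p - C) + p * q - q * q"
      unfolding N_def by algebra
    moreover have "r dvd p + C" "r dvd q" using r unfolding p_def q_def by simp_all
    ultimately have "r dvd C * C" using r by simp
    then show False using no_common_prime[OF r(1) A''A[OF r(2)]] r(1) by (simp add: prime_dvd_mult_iff)
  qed
  have 2: False if r: "prime r" "r dvd A''" "r dvd N" "r dvd L" for r
  proof -
    have "k = 3 * L - 5 * A''" using L by simp
    then have "r dvd k" using r by simp
    then show False using kN r by blast
  qed
  have 3: False if r: "prime r" "r dvd A''" "r dvd p" "r dvd q" for r
  proof -
    have "k = q + 10 * A''" by (simp add: q_def)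
    then have "r dvd k" using r by simp
    moreover have "r dvd N" using r unfolding N_def by (simp add: power2_eq_square)
    ultimately show False using kN r by blast
  qed
  have 4: "\<not> 5 dvd N"
    using five_dvd_norm[of p q] five unfolding N_def p_def q_def by presburger
  obtain n l a b P Q where o: "A'' = n * l" "L = - 10 * l ^ 3" "n = a\<^sup>2 - a * b + b\<^sup>2"
    "P = a^3 - 3*a*b^2 + b^3" "Q = 3*a*b*(a - b)"
    "p = P \<and> q = Q \<or> p = - Q \<and> q = P - Q \<or> p = Q - P \<and> q = - P"
    by (rule norm_coprime_factor[of L p q A'', folded N_def, OF 1 _ _ 4 5]) (use 2 3 in blast)+
  have Q3: "3 dvd Q" unfolding o by simp
  have q3: "3 dvd q" using L unfolding q_def by presburger
  have "\<not> 3 dvd p" using q3 5 unfolding N_def by (auto simp: power2_eq_square)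
  then have pq: "q = Q" using o(6) q3 Q3 by presburger
  have "3 * L - q = 15 * A''" unfolding q_def L[symmetric] by simp
  then have rel: "10 * l ^ 3 + 5 * (n * l) + a * b * (a - b) = 0" using o pq by simp
  \<comment> \<open>the solution of \<open>u + v + w = 15 l\<close> and \<open>u + v \<omega> + w \<omega>\<^sup>2 = - (1 + 2 \<omega>) (a + b \<omega>)\<close>; the cube of the
    right-hand side is \<open>5 A + 3 \<omega> B + 3 \<omega>\<^sup>2 C\<close>\<close>
  define u v w where "u = 5 * l + b" and "v = 5 * l - a" and "w = 5 * l + a - b"
  have "u * v * w = 5 * (3 * l) ^ 3"
    using rel unfolding o(3) u_def v_def w_def by algebra
  moreover have "u + v + w = 5 * (3 * l)" by (simp add: u_def v_def w_def)
  moreover have nl: "n \<noteq> 0" "l \<noteq> 0" using A0 o(1) A'' by auto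
  moreover have "\<bar>3 * l\<bar> < \<bar>A * B * C\<bar>"
  proof -
    have "\<bar>n * B * C\<bar> \<ge> 1" using nl BC_nonzero by (smt (verit) mult_eq_0_iff)
    then have "\<bar>9 * l\<bar> * 1 \<le> \<bar>9 * l\<bar> * \<bar>n * B * C\<bar>" by (intro mult_left_mono) auto
    also have "\<dots> = \<bar>A * B * C\<bar>" by (simp add: A'' o(1) abs_mult)
    finally show ?thesis using nl by simp
  qed
  ultimately show ?thesis by (metis mult_eq_0_iff zero_neq_numeral)
qed

lemma descent:
  "\<exists>u v w t. u * v * w = 5 * t ^ 3 \<and> u + v + w = 5 * t \<and> t \<noteq> 0 \<and> \<bar>t\<bar> < \<bar>A * B * C\<bar>"
proof (cases "3 dvd A")
  case True
  then obtain A' where A': "A = 3 * A'" by (auto simp: dvd_def)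
  then have "3 dvd A'" using no_point_A_exactly_divisible_by_3 by blast
  then obtain A'' where "A' = 3 * A''" by (auto simp: dvd_def)
  then show ?thesis using descent_9_dvd_A[of A''] A' by simp
qed (rule descent_A_unit_mod_3)

end

section \<open>Descent on the sum of the coordinates\<close>

lemma primitive_descent:
  fixes u v w t :: int
  assumes eq: "u * v * w = 5 * t ^ 3"
    and cop: "coprime u v" "coprime u w" "coprime v w"
    and u5: "5 dvd u" and sum: "u + v + w = 5 * t" and t0: "t \<noteq> 0"
  shows "\<exists>u' v' w' t'. u' * v' * w' = 5 * t' ^ 3 \<and> u' + v' + w' = 5 * t' \<and> t' \<noteq> 0 \<and> \<bar>t'\<bar> < \<bar>t\<bar>"
proof -
  obtain u1 where u1: "u = 5 * u1" using u5 by (auto simp: dvd_def)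
  have e: "u1 * v * w = t ^ 3" using eq u1 by simp
  have c: "coprime u1 v" "coprime u1 w" "coprime 5 v" "coprime 5 w"
    using cop(1,2) unfolding u1 by simp_all
  obtain A where A: "u1 = A ^ 3"
    using coprime_cube_factor_int[of u1 "v * w" t] c e by (metis coprime_mult_right_iff mult.assoc)
  obtain B where B: "v = B ^ 3"
    using coprime_cube_factor_int[of v "u1 * w" t] c cop(3) e
    by (metis coprime_mult_right_iff coprime_commute mult.assoc mult.commute)
  obtain C where C: "w = C ^ 3"
    using coprime_cube_factor_int[of w "u1 * v" t] c cop(3) e
    by (metis coprime_mult_right_iff coprime_commute mult.commute)
  have "(A * B * C) ^ 3 = t ^ 3" using e A B C by (simp add: power_mult_distrib)
  then have t: "t = A * B * C" using cube_inject_int by metis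
  interpret primitive_isogenous_point A B C
  proof
    show "5 * A ^ 3 + B ^ 3 + C ^ 3 = 5 * A * B * C" using sum u1 A B C t by simp
    show "coprime A B" "coprime A C" "coprime B C" using c(1,2) cop(3) unfolding A B C by simp_all
    show "\<not> 5 dvd B" "\<not> 5 dvd C" using c(3,4) unfolding B C
      by (auto simp: coprime_absorb_left)
    show "A \<noteq> 0" using t t0 by auto
  qed
  show ?thesis using descent unfolding t .
qed

text \<open>
  A prime that divides two of \<open>u\<close>, \<open>v\<close>, \<open>w\<close> divides \<open>5 t\<close>, hence the third one, and dividing
  by it gives a smaller solution. So in a solution of minimal \<open>\<bar>t\<bar> > 0\<close> the three numbers are pairwise
  coprime, and the descent applies after a permutation.
\<close>

lemma cubic_uvw_trivial:
  fixes u v w t :: int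
  assumes "u * v * w = 5 * t ^ 3" "u + v + w = 5 * t"
  shows "t = 0"
  using assms
proof (induction "nat \<bar>t\<bar>" arbitrary: u v w t rule: less_induct)
  case less
  note eq = less.prems(1) and sum = less.prems(2)
  show ?case
  proof (rule ccontr)
    assume t0: "t \<noteq> 0"
    have min: False if "u' * v' * w' = 5 * t' ^ 3" "u' + v' + w' = 5 * t'" "t' \<noteq> 0" "\<bar>t'\<bar> < \<bar>t\<bar>"
      for u' v' w' t'
      using less.hyps[OF _ that(1,2)] that(3,4) by linarith
    have triple: False if r: "prime r" "r dvd u" "r dvd v" "r dvd w" for r
    proof -
      obtain u' v' w' where d: "u = r * u'" "v = r * v'" "w = r * w'" using r by (auto simp: dvd_def)
      have r2: "r \<ge> 2" using r(1) by (rule prime_ge_2_int)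
      have "r dvd t"
      proof (cases "r = 5")
        case True
        have "t ^ 3 = 5 * (5 * (u' * v' * w'))" using eq unfolding d True by simp
        then have "5 dvd t ^ 3" by simp
        then show ?thesis unfolding True by (rule prime_dvd_power_int[rotated]) simp
      next
        case False
        have "r dvd 5 * t" unfolding sum[symmetric] using r by simp
        then show ?thesis using False r(1) prime_dvd_mult_iff[OF r(1)] primes_dvd_imp_eq[OF r(1), of 5] by auto
      qed
      then obtain t' where t': "t = r * t'" by (auto simp: dvd_def)
      have "r ^ 3 * (u' * v' * w') = r ^ 3 * (5 * t' ^ 3)"
        using eq unfolding d t' by (simp add: power3_eq_cube algebra_simps)
      moreover have "r * (u' + v' + w') = r * (5 * t')"
        using sum unfolding d t' by (simp add: algebra_simps)
      moreover have "t' \<noteq> 0" using t0 t' by auto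
      moreover have "\<bar>t'\<bar> * 1 < \<bar>t'\<bar> * r"
        using \<open>t' \<noteq> 0\<close> r2 by (intro mult_strict_left_mono) auto
      then have "\<bar>t'\<bar> < \<bar>t\<bar>" using r2 by (simp add: t' abs_mult mult.commute)
      ultimately show False using min[of u' v' w' t'] r2 by simp
    qed
    have third: "r dvd x1 + x2 + x3"
      if "prime r" "r dvd x1" "x1 * x2 * x3 = 5 * t ^ 3" "x1 + x2 + x3 = 5 * t" for r x1 x2 x3
    proof -
      have "r dvd 5 * t ^ 3" using that(2,3) by (metis dvd_mult2)
      then have "r dvd 5 \<or> r dvd t" using that(1) by (metis prime_dvd_mult_iff prime_dvd_power)
      then show ?thesis unfolding that(4) by auto
    qed
    have pair: "coprime x1 x2" if x: "x1 * x2 * x3 = 5 * t ^ 3" "x1 + x2 + x3 = 5 * t"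
       and p: "\<And>r. prime r \<Longrightarrow> r dvd x1 \<Longrightarrow> r dvd x2 \<Longrightarrow> r dvd x3 \<Longrightarrow> False" for x1 x2 x3
    proof (rule coprime_int_by_primes)
      fix r assume r: "prime r" "r dvd x1" "r dvd x2"
      then have "r dvd (x1 + x2 + x3) - x1 - x2" using third[OF r(1,2) x] by (intro dvd_diff)
      then show False using p r by simp
    qed
    have cop: "coprime u v" "coprime u w" "coprime v w"
      using triple eq sum pair[of u v w] pair[of u w v] pair[of v w u]
      by (auto simp: ac_simps)
    have "5 dvd u * v * w" unfolding eq by simp
    then consider "5 dvd u" | "5 dvd v" | "5 dvd w" by (auto simp: prime_dvd_mult_iff)
    then show False
    proof cases
      case 1
      then show ?thesis using primitive_descent[of u v w t] eq sum cop t0 min by blast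
    next
      case 2
      have "v * u * w = 5 * t ^ 3" "v + u + w = 5 * t" using eq sum by (simp_all add: ac_simps)
      then show ?thesis using primitive_descent[of v u w t] 2 cop t0 min coprime_commute by blast
    next
      case 3
      have "w * u * v = 5 * t ^ 3" "w + u + v = 5 * t" using eq sum by (simp_all add: ac_simps)
      then show ?thesis using primitive_descent[of w u v t] 3 cop t0 min coprime_commute by blast
    qed
  qed
qed

section \<open>Rational points\<close>

lemma complete_form_iterated_sum:
  "complete_form n x y z = (\<Sum>h\<le>n. \<Sum>i\<le>n - h. x ^ h * y ^ i * z ^ (n - h - i))"
proof -
  have "(\<Sum>h\<le>n. \<Sum>i\<le>n - h. x ^ h * y ^ i * z ^ (n - h - i)) =
      (\<Sum>(h, i) \<in> (SIGMA h:{..n}. {..n - h}). x ^ h * y ^ i * z ^ (n - h - i))"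
    by (rule sum.Sigma) auto
  also have "\<dots> = complete_form n x y z"
    unfolding complete_form_def
    by (rule sum.reindex_bij_witness[of _ "\<lambda>(h, i, j). (h, i)" "\<lambda>(h, i). (h, i, n - h - i)"]) auto
  finally show ?thesis by (rule sym)
qed

lemma complete_form_3:
  "complete_form 3 x y z =
     x^3 + y^3 + z^3 + x^2*y + x^2*z + y^2*x + y^2*z + z^2*x + z^2*y + x*y*z"
  by (simp add: complete_form_iterated_sum eval_nat_numeral algebra_simps)

lemma complete_form_3_linear_forms:
  "(2 * (x + y + z) - x) * (2 * (x + y + z) - y) * (2 * (x + y + z) - z)
     = 5 * (x + y + z) ^ 3 - complete_form 3 x y z"
  unfolding complete_form_3 by (simp add: power2_eq_square power3_eq_cube algebra_simps)

lemma common_denominator_rat3: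
  fixes x y z :: rat
  obtains d a b c :: int where "d \<noteq> 0" "x * of_int d = of_int a" "y * of_int d = of_int b" "z * of_int d = of_int c"
proof -
  obtain a1 d1 where x: "x = of_int a1 / of_int d1" "d1 \<noteq> 0" by (metis Fract_of_int_quotient Rat_cases less_irrefl)
  obtain a2 d2 where y: "y = of_int a2 / of_int d2" "d2 \<noteq> 0" by (metis Fract_of_int_quotient Rat_cases less_irrefl)
  obtain a3 d3 where z: "z = of_int a3 / of_int d3" "d3 \<noteq> 0" by (metis Fract_of_int_quotient Rat_cases less_irrefl)
  show ?thesis
    using x y z by (intro that[of "d1 * d2 * d3" "a1 * d2 * d3" "a2 * d1 * d3" "a3 * d1 * d2"]) auto
qed

text \<open>
  On the line \<open>x + y + z = 0\<close> the three linear forms are \<open>-x\<close>, \<open>-y\<close>, \<open>-z\<close>, so that the cubic restricts to \<open>x y z\<close>.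
\<close>

lemma complete_form_3_zero_iff:
  fixes x y z :: rat
  shows "complete_form 3 x y z = 0 \<longleftrightarrow> x + y + z = 0 \<and> (x = 0 \<or> y = 0 \<or> z = 0)"
proof
  assume h: "complete_form 3 x y z = 0"
  obtain d a b c :: int where d: "d \<noteq> 0" and
    e: "x * of_int d = of_int a" "y * of_int d = of_int b" "z * of_int d = of_int c"
    by (rule common_denominator_rat3)
  define s where "s = a + b + c"
  have "complete_form 3 (of_int d * x) (of_int d * y) (of_int d * z) = 0"
    using h by (simp add: complete_form_scale)
  then have "complete_form 3 (of_int a) (of_int b) (of_int c :: rat) = 0"
    using e by (simp add: mult.commute)
  from complete_form_3_linear_forms[of "of_int a" "of_int b" "of_int c :: rat", unfolded this]
  have "of_int ((2 * s - a) * (2 * s - b) * (2 * s - c)) = (of_int (5 * s ^ 3) :: rat)"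
    by (simp add: s_def)
  then have "(2 * s - a) * (2 * s - b) * (2 * s - c) = 5 * s ^ 3" by (simp only: of_int_eq_iff)
  moreover have "(2 * s - a) + (2 * s - b) + (2 * s - c) = 5 * s" by (simp add: s_def)
  ultimately have "s = 0" by (rule cubic_uvw_trivial)
  moreover have "(x + y + z) * of_int d = of_int s" using e by (simp add: s_def algebra_simps)
  ultimately have s0: "x + y + z = 0" using d by simp
  then have "x * y * z = 0" using complete_form_3_linear_forms[of x y z] h by simp
  then show "x + y + z = 0 \<and> (x = 0 \<or> y = 0 \<or> z = 0)" using s0 by auto
next
  assume "x + y + z = 0 \<and> (x = 0 \<or> y = 0 \<or> z = 0)"
  then show "complete_form 3 x y z = 0"
    using complete_form_3_linear_forms[of x y z] by auto
qed

lemma proj_point_scale: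
  assumes "c \<noteq> 0" "(x, y, z) \<noteq> (0, 0, 0)"
  shows "proj_point (c * x) (c * y) (c * z) = proj_point x y z"
proof -
  have "((x, y, z), (c * x, c * y, c * z)) \<in> proj_rel"
    using assms by (auto simp: proj_rel_def)
  then show ?thesis
    unfolding proj_point_def by (rule equiv_class_eq[OF equiv_proj_rel, symmetric])
qed

theorem lemma4p1:
  "(curve_points 3 :: (rat \<times> rat \<times> rat) set set) =
     {proj_point 1 (-1) 0, proj_point (-1) 0 1, proj_point 0 1 (-1)}"
proof (intro equalityI subsetI)
  fix P :: "(rat \<times> rat \<times> rat) set"
  assume P: "P \<in> curve_points 3"
  then obtain x y z where xyz: "(x, y, z) \<noteq> (0, 0, 0)" and P_eq: "P = proj_point x y z"
    unfolding curve_points_def proj_plane_def proj_point_def by (auto elim!: quotientE)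
  have "complete_form 3 x y z = 0"
    using P proj_point_in_curve_points_iff[OF xyz] unfolding P_eq by blast
  then consider "x = 0" "z = - y" | "y = 0" "x = - z" | "z = 0" "y = - x"
    unfolding complete_form_3_zero_iff by fastforce
  then show "P \<in> {proj_point 1 (-1) 0, proj_point (-1) 0 1, proj_point 0 1 (-1)}"
  proof cases
    case 1
    then show ?thesis using xyz proj_point_scale[of y 0 1 "-1"] unfolding P_eq by auto
  next
    case 2
    then show ?thesis using xyz proj_point_scale[of z "-1" 0 1] unfolding P_eq by auto
  next
    case 3
    then show ?thesis using xyz proj_point_scale[of x 1 "-1" 0] unfolding P_eq by auto
  qed
next
  fix P :: "(rat \<times> rat \<times> rat) set"
  assume "P \<in> {proj_point 1 (-1) 0, proj_point (-1) 0 1, proj_point 0 1 (-1)}"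
  then show "P \<in> curve_points 3"
    by (auto simp: proj_point_in_curve_points_iff complete_form_3_zero_iff)
qed

end
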